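(* The index set $\{i\mid R_i\text{ is self-full}\}$ is $\Pi^0_3$-complete.
   Context: A ceer is a computably enumerable equivalence relation on $\omega$. $(R_z)_{z\in\omega}$ is a fixed acceptable indexing of all ceers (for instance $R_z$ is the equivalence relation on $\omega$ generated by the $z$-th c.e. subset of $\omega^2$). A computable function $g$ is a reduction of $E$ to $E$ if $x\mathrel{E}y\iff g(x)\mathrel{E}g(y)$ for all $x,y$. A ceer $E$ is self-full if for every such reduction $g$ of $E$ to $E$ and every $j\in\omega$ there is $k$ with $g(k)\mathrel{E}j$. *)

theory Defs
  imports "HOL-Library.Nat_Bijection"
begin

section \<open>Partial recursive functions\<close>

text \<open>
  Partial recursive functions are taken as unary partial functions on the natural numbers;
  several arguments are passed through the Cantor pairing bijection \<^const>\<open>prod_encode\<close>.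
  The programs below are Kleene's schemes (zero, successor, projections, tupling, composition,
  primitive recursion, minimisation) in this unary form.  The identity is
  \<open>CPair CFst CSnd\<close>, because the pairing is onto.
\<close>

datatype code =
    CZero
  | CSucc
  | CFst
  | CSnd
  | CPair code code
  | CComp code code
  | CPrec code code
  | CMu code

text \<open>
  \<open>CPrec c d\<close> computes the function \<open>h\<close> with \<open>h(a,0) = c(a)\<close> and
  \<open>h(a,n+1) = d(a,(n,h(a,n)))\<close>.  \<open>CMu c\<close> maps \<open>x\<close> to the least \<open>n\<close> with \<open>c(x,n) = 0\<close>, and it
  is undefined if no such \<open>n\<close> exists or if \<open>c(x,m)\<close> is undefined for some \<open>m\<close> below it.
\<close>

primrec eval :: "code \<Rightarrow> nat \<Rightarrow> nat option" where
  "eval CZero x = Some 0"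
| "eval CSucc x = Some (Suc x)"
| "eval CFst x = Some (fst (prod_decode x))"
| "eval CSnd x = Some (snd (prod_decode x))"
| "eval (CPair c d) x =
     Option.bind (eval c x) (\<lambda>a. Option.bind (eval d x) (\<lambda>b. Some (prod_encode (a, b))))"
| "eval (CComp c d) x = Option.bind (eval d x) (eval c)"
| "eval (CPrec c d) x =
     (let (a, n) = prod_decode x in
      rec_nat (eval c a)
        (\<lambda>m r. Option.bind r (\<lambda>y. eval d (prod_encode (a, prod_encode (m, y))))) n)"
| "eval (CMu c) x =
     (if \<exists>n. eval c (prod_encode (x, n)) = Some 0 \<and>
             (\<forall>m<n. eval c (prod_encode (x, m)) \<noteq> None)
      then Some (LEAST n. eval c (prod_encode (x, n)) = Some 0)
      else None)"

definition computable :: "(nat \<Rightarrow> nat) \<Rightarrow> bool" where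
  "computable f \<longleftrightarrow> (\<exists>c. \<forall>x. eval c x = Some (f x))"

definition decidable :: "nat set \<Rightarrow> bool" where
  "decidable A \<longleftrightarrow> computable (\<lambda>x. if x \<in> A then 1 else 0)"

definition ce :: "nat set \<Rightarrow> bool" where
  "ce A \<longleftrightarrow> (\<exists>c. A = dom (eval c))"

text \<open>A Goedel numbering of the programs in which every number is an index; it fixes the
   enumeration \<open>W\<close> of the c.e. sets.\<close>

function decode :: "nat \<Rightarrow> code" where
  "decode n =
     (if n = 0 then CZero else if n = 1 then CSucc else if n = 2 then CFst else if n = 3 then CSnd
      else let k = (n - 4) div 4; a = fst (prod_decode k); b = snd (prod_decode k) in
        if n mod 4 = 0 then CPair (decode a) (decode b)
        else if n mod 4 = 1 then CComp (decode a) (decode b)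
        else if n mod 4 = 2 then CPrec (decode a) (decode b)
        else CMu (decode k))"
  by pat_completeness auto

lemma fst_prod_decode_le: "fst (prod_decode k) \<le> k"
  by (metis le_prod_encode_1 prod.collapse prod_decode_inverse)

lemma snd_prod_decode_le: "snd (prod_decode k) \<le> k"
  by (metis le_prod_encode_2 prod.collapse prod_decode_inverse)

termination
proof (relation "measure id", goal_cases)
  case 1
  then show ?case by simp
qed (use fst_prod_decode_le snd_prod_decode_le in
      \<open>auto intro!: le_less_trans[OF fst_prod_decode_le] le_less_trans[OF snd_prod_decode_le]\<close>)

declare decode.simps [simp del]

lemma decode_eqs:
  "decode 0 = CZero" "decode 1 = CSucc" "decode 2 = CFst" "decode 3 = CSnd"
  "decode (4 * prod_encode (a, b) + 4) = CPair (decode a) (decode b)"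
  "decode (4 * prod_encode (a, b) + 5) = CComp (decode a) (decode b)"
  "decode (4 * prod_encode (a, b) + 6) = CPrec (decode a) (decode b)"
  "decode (4 * k + 7) = CMu (decode k)"
proof -
  have "(4 * m + 5 - 4) div 4 = m" "(4 * m + 6 - 4) div 4 = m" "(4 * m + 7 - 4) div 4 = m"
    "(4 * m + 5) mod 4 = 1" "(4 * m + 6) mod 4 = 2" "(4 * m + 7) mod 4 = 3" for m :: nat
    by presburger+
  note eqs = this
  show "decode 0 = CZero" "decode 1 = CSucc" "decode 2 = CFst" "decode 3 = CSnd"
    "decode (4 * prod_encode (a, b) + 4) = CPair (decode a) (decode b)"
    by (subst decode.simps, simp add: Let_def)+
  show "decode (4 * prod_encode (a, b) + 5) = CComp (decode a) (decode b)"
    by (subst decode.simps) (simp only: Let_def eqs, simp)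
  show "decode (4 * prod_encode (a, b) + 6) = CPrec (decode a) (decode b)"
    by (subst decode.simps) (simp only: Let_def eqs, simp)
  show "decode (4 * k + 7) = CMu (decode k)"
    by (subst decode.simps) (simp only: Let_def eqs, simp)
qed

lemma surj_decode: "surj decode"
proof -
  have "\<exists>n. decode n = c" for c
    by (induction c) (metis decode_eqs)+
  then show ?thesis unfolding surj_def by metis
qed

definition W :: "nat \<Rightarrow> nat set" where
  "W e = dom (eval (decode e))"

section \<open>The arithmetical hierarchy and completeness\<close>

fun Sigma0 :: "nat \<Rightarrow> nat set set" and Pi0 :: "nat \<Rightarrow> nat set set" where
  "Sigma0 0 = {A. decidable A}"
| "Sigma0 (Suc n) = {{x. \<exists>a. prod_encode (x, a) \<in> B} | B. B \<in> Pi0 n}"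
| "Pi0 0 = {A. decidable A}"
| "Pi0 (Suc n) = {{x. \<forall>a. prod_encode (x, a) \<in> B} | B. B \<in> Sigma0 n}"

definition many_one_reducible :: "nat set \<Rightarrow> nat set \<Rightarrow> bool" where
  "many_one_reducible B A \<longleftrightarrow> (\<exists>f. computable f \<and> (\<forall>x. x \<in> B \<longleftrightarrow> f x \<in> A))"

definition complete_for :: "nat set set \<Rightarrow> nat set \<Rightarrow> bool" where
  "complete_for \<Gamma> A \<longleftrightarrow> A \<in> \<Gamma> \<and> (\<forall>B\<in>\<Gamma>. many_one_reducible B A)"

section \<open>Ceers\<close>

definition ceer :: "(nat \<times> nat) set \<Rightarrow> bool" where
  "ceer E \<longleftrightarrow> equiv UNIV E \<and> ce (prod_encode ` E)"

definition reduction :: "(nat \<times> nat) set \<Rightarrow> (nat \<times> nat) set \<Rightarrow> (nat \<Rightarrow> nat) \<Rightarrow> bool" where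
  "reduction E F g \<longleftrightarrow> computable g \<and> (\<forall>x y. (x, y) \<in> E \<longleftrightarrow> (g x, g y) \<in> F)"

definition self_full :: "(nat \<times> nat) set \<Rightarrow> bool" where
  "self_full E \<longleftrightarrow> ceer E \<and> (\<forall>g. reduction E E g \<longrightarrow> (\<forall>j. \<exists>k. (g k, j) \<in> E))"

text \<open>
  The standard indexing: the \<open>z\<close>-th ceer is the equivalence relation generated by the
  \<open>z\<close>-th c.e. set of pairs.
\<close>

definition std_ceer :: "nat \<Rightarrow> (nat \<times> nat) set" where
  "std_ceer z = (let r = {(x, y). prod_encode (x, y) \<in> W z} in (r \<union> r\<inverse>)\<^sup>*)"

text \<open>
  Acceptability in the sense of Rogers: indices can be translated computably to and from the
  standard indexing.
\<close>

definition acceptable_ceer_indexing :: "(nat \<Rightarrow> (nat \<times> nat) set) \<Rightarrow> bool" where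
  "acceptable_ceer_indexing R \<longleftrightarrow>
     (\<exists>f. computable f \<and> (\<forall>z. R z = std_ceer (f z))) \<and>
     (\<exists>g. computable g \<and> (\<forall>z. std_ceer z = R (g z)))"

lemma computable_id: "computable (\<lambda>x. x)"
  unfolding computable_def by (rule exI[of _ "CPair CFst CSnd"]) simp

lemma acceptable_std_ceer: "acceptable_ceer_indexing std_ceer"
  unfolding acceptable_ceer_indexing_def using computable_id by blast

end

theory Submission
  imports Defs
begin

text \<open>
  Upper bound: self-fullness of \<open>std_ceer z\<close> says that for every program \<open>e\<close> and every \<open>j\<close>,
  either \<open>e\<close> is not total, or it fails to be a reduction at some pair, or it hits the class of \<open>j\<close>;
  the three alternatives are \<open>\<Sigma>\<^sub>2\<close>.

  Hardness: the ceer \<open>Id \<union> A \<times> A\<close> is self-full iff the complement of \<open>A\<close> has no infinite c.e.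
  subset.  Indeed an infinite c.e. set of singleton classes can be shifted, while for a reduction
  \<open>g\<close> missing the class of \<open>j\<close> the iterates \<open>j, g(j), g(g(j)), \<dots>\<close> are pairwise inequivalent, so
  that at most one of them lies in \<open>A\<close>.  Given \<open>B = {x. \<forall>a. \<exists>b. \<forall>c. D x a b c}\<close>, take \<open>A\<close> to
  consist of a fixed set \<open>P\<close> and of all but a decidable set of elements, the free ones, whose
  column \<open>a\<close> is finite iff \<open>\<exists>b. \<forall>c. D x a b c\<close>.  The set \<open>P\<close> is
  constructed as Post's simple set: it is finite on each column, and it meets every c.e. set that
  has elements in arbitrarily late columns.
\<close>

section \<open>Closure properties of the computable functions\<close>

abbreviation pair :: "nat \<Rightarrow> nat \<Rightarrow> nat" where
  "pair a b \<equiv> prod_encode (a, b)"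

abbreviation pi1 :: "nat \<Rightarrow> nat" where
  "pi1 z \<equiv> fst (prod_decode z)"

abbreviation pi2 :: "nat \<Rightarrow> nat" where
  "pi2 z \<equiv> snd (prod_decode z)"

lemma pair_pi [simp]: "pair (pi1 z) (pi2 z) = z"
  by simp

text \<open>Merges two existential quantifiers into one; used when contracting prefixes of the
  hierarchy.\<close>

lemma ex_pair: "(\<exists>z. P (pi1 z) (pi2 z)) \<longleftrightarrow> (\<exists>a b. P a b)"
proof
  assume "\<exists>a b. P a b"
  then obtain a b where "P a b" by blast
  then show "\<exists>z. P (pi1 z) (pi2 z)" by (intro exI[of _ "pair a b"]) simp
qed blast

named_theorems comp_intros

declare computable_id [comp_intros]

lemma computableE:
  assumes "computable f"
  obtains c where "\<And>x. eval c x = Some (f x)"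
  using assms unfolding computable_def by blast

lemma computable_cong: "computable f \<Longrightarrow> (\<And>x. f x = g x) \<Longrightarrow> computable g"
  by (metis ext)

lemma computable_comp:
  assumes "computable f" "computable g"
  shows "computable (\<lambda>x. f (g x))"
proof -
  obtain c d where "\<And>x. eval c x = Some (f x)" "\<And>x. eval d x = Some (g x)"
    using assms by (metis computableE)
  then have "\<forall>x. eval (CComp c d) x = Some (f (g x))" by simp
  then show ?thesis unfolding computable_def by blast
qed

lemma computable_pair [comp_intros]:
  assumes "computable f" "computable g"
  shows "computable (\<lambda>x. pair (f x) (g x))"
proof -
  obtain c d where "\<And>x. eval c x = Some (f x)" "\<And>x. eval d x = Some (g x)"
    using assms by (metis computableE)
  then have "\<forall>x. eval (CPair c d) x = Some (pair (f x) (g x))" by simp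
  then show ?thesis unfolding computable_def by blast
qed

lemma computable_pi1 [comp_intros]: "computable f \<Longrightarrow> computable (\<lambda>x. pi1 (f x))"
proof (rule computable_comp[of pi1])
  show "computable pi1" unfolding computable_def by (rule exI[of _ CFst]) simp
qed

lemma computable_pi2 [comp_intros]: "computable f \<Longrightarrow> computable (\<lambda>x. pi2 (f x))"
proof (rule computable_comp[of pi2])
  show "computable pi2" unfolding computable_def by (rule exI[of _ CSnd]) simp
qed

lemma computable_Suc [comp_intros]: "computable f \<Longrightarrow> computable (\<lambda>x. Suc (f x))"
proof (rule computable_comp[of Suc])
  show "computable Suc" unfolding computable_def by (rule exI[of _ CSucc]) simp
qed

lemma computable_const [comp_intros]: "computable (\<lambda>x. k)"
proof (induction k)
  case 0
  show ?case unfolding computable_def by (rule exI[of _ CZero]) simp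
qed (rule computable_Suc)

text \<open>\<open>CPrec\<close> carries a single parameter, so the whole argument \<open>x\<close>
  is passed through it, with the recursion depth \<open>h x\<close> paired on. The step function is
  tested on codes of \<open>(x, (m, r))\<close>.\<close>

lemma computable_rec_nat [comp_intros]:
  assumes "computable f" "computable (\<lambda>z. g (pi1 z) (pi1 (pi2 z)) (pi2 (pi2 z)))" "computable h"
  shows "computable (\<lambda>x. rec_nat (f x) (g x) (h x))"
proof -
  obtain c where c: "\<And>x. eval c x = Some (f x)"
    using computableE[OF assms(1)] by blast
  obtain d where d: "\<And>z. eval d z = Some (g (pi1 z) (pi1 (pi2 z)) (pi2 (pi2 z)))"
    using computableE[OF assms(2)] by blast
  have *: "eval (CPrec c d) (pair x n) = Some (rec_nat (f x) (g x) n)" for x n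
    by (induction n) (simp_all add: c d)
  have "eval (CPrec c d) z = Some (rec_nat (f (pi1 z)) (g (pi1 z)) (pi2 z))" for z
    using *[of "pi1 z" "pi2 z"] by (simp only: pair_pi)
  then have "computable (\<lambda>z. rec_nat (f (pi1 z)) (g (pi1 z)) (pi2 z))"
    unfolding computable_def by blast
  from computable_comp[OF this computable_pair[OF computable_id assms(3)]]
  show ?thesis by simp
qed

text \<open>A case distinction is a primitive recursion of depth 0 or 1, the depth being the
  characteristic function of \<open>P\<close>.\<close>

lemma computable_if [comp_intros]:
  assumes "decidable {x. P x}" "computable f" "computable g"
  shows "computable (\<lambda>x. if P x then f x else g x)"
proof -
  have "computable (\<lambda>x. rec_nat (g x) (\<lambda>_ _. f x) (if P x then 1 else 0))"
    using assms(1) unfolding decidable_def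
    by (intro comp_intros computable_comp[OF assms(2)] assms(3)) simp
  moreover have "rec_nat (g x) (\<lambda>_ _. f x) (if P x then 1 else 0) = (if P x then f x else g x)"
    for x by simp
  ultimately show ?thesis by simp
qed

lemma decidableI: "computable (\<lambda>x. if P x then 1 else 0) \<Longrightarrow> decidable {x. P x}"
  unfolding decidable_def by simp

lemma decidable_comp:
  assumes "decidable {x. P x}" "computable f"
  shows "decidable {x. P (f x)}"
  using computable_comp[OF _ assms(2), of "\<lambda>x. if P x then 1 else 0"] assms(1)
  unfolding decidable_def by simp

lemma decidable_const [comp_intros]: "decidable {x. P}"
  by (rule decidableI, rule computable_const)

lemma decidable_not [comp_intros]: "decidable {x. P x} \<Longrightarrow> decidable {x. \<not> P x}"
  by (rule decidableI, rule computable_cong[OF computable_if[of P "\<lambda>_. 0" "\<lambda>_. 1"]])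
     (auto intro: comp_intros)

lemma decidable_if [comp_intros]:
  assumes "decidable {x. P x}" "decidable {x. Q x}" "decidable {x. R x}"
  shows "decidable {x. if P x then Q x else R x}"
proof (rule decidableI)
  have "computable (\<lambda>x. if P x then (if Q x then 1 else 0) else (if R x then 1 else 0))"
    by (intro comp_intros assms)
  then show "computable (\<lambda>x. if if P x then Q x else R x then 1 else 0)"
    by (rule computable_cong) auto
qed

lemma decidable_and [comp_intros]:
  assumes "decidable {x. P x}" "decidable {x. Q x}"
  shows "decidable {x. P x \<and> Q x}"
proof -
  have "{x. if P x then Q x else False} = {x. P x \<and> Q x}" by auto
  then show ?thesis using decidable_if[OF assms decidable_const[of False]] by simp
qed

lemma decidable_or [comp_intros]:
  assumes "decidable {x. P x}" "decidable {x. Q x}"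
  shows "decidable {x. P x \<or> Q x}"
  using decidable_not[OF decidable_and[OF assms[THEN decidable_not]]] by (simp only: de_Morgan_conj not_not)

lemma decidable_imp [comp_intros]:
  assumes "decidable {x. P x}" "decidable {x. Q x}"
  shows "decidable {x. P x \<longrightarrow> Q x}"
  unfolding imp_conv_disj by (intro decidable_or decidable_not assms)

section \<open>Arithmetic and comparisons\<close>

lemma decidable_eq_0:
  assumes "computable f"
  shows "decidable {x. f x = 0}"
proof (rule decidableI)
  have "computable (\<lambda>x. rec_nat 1 (\<lambda>_ _. 0) (f x))"
    by (intro comp_intros assms)
  then show "computable (\<lambda>x. if f x = 0 then 1 else 0)"
    by (rule computable_cong) (auto simp: gr0_conv_Suc)
qed

lemma computable_pred:
  assumes "computable f"
  shows "computable (\<lambda>x. f x - 1)"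
proof -
  have "computable (\<lambda>x. rec_nat 0 (\<lambda>m _. m) (f x))"
    by (intro comp_intros assms)
  moreover have "rec_nat 0 (\<lambda>m _. m) n = n - 1" for n :: nat
    by (cases n) auto
  ultimately show ?thesis by simp
qed

lemma computable_diff [comp_intros]:
  assumes "computable f" "computable g"
  shows "computable (\<lambda>x. f x - g x)"
proof -
  have "computable (\<lambda>x. rec_nat (f x) (\<lambda>_ r. r - 1) (g x))"
    by (intro comp_intros computable_pred assms)
  moreover have "rec_nat m (\<lambda>_ r. r - 1) n = m - n" for m n :: nat
    by (induction n) auto
  ultimately show ?thesis by simp
qed

lemma decidable_le [comp_intros]:
  assumes "computable f" "computable g"
  shows "decidable {x. f x \<le> g x}"
  using decidable_eq_0[OF computable_diff[OF assms]] by simp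

lemma decidable_less [comp_intros]:
  assumes "computable f" "computable g"
  shows "decidable {x. f x < g x}"
  using decidable_not[OF decidable_le[OF assms(2,1)]] by (simp add: not_le)

lemma decidable_eq [comp_intros]:
  assumes "computable f" "computable g"
  shows "decidable {x. f x = g x}"
  using decidable_and[OF decidable_le[OF assms] decidable_le[OF assms(2,1)]]
  by (simp add: order_eq_iff)

lemma computable_add [comp_intros]:
  assumes "computable f" "computable g"
  shows "computable (\<lambda>x. f x + g x)"
proof -
  have "computable (\<lambda>x. rec_nat (f x) (\<lambda>_ r. Suc r) (g x))"
    by (intro comp_intros assms)
  moreover have "rec_nat m (\<lambda>_ r. Suc r) n = m + n" for m n
    by (induction n) auto
  ultimately show ?thesis by simp
qed

lemma computable_mult [comp_intros]:
  assumes "computable f" "computable g"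
  shows "computable (\<lambda>x. f x * g x)"
proof -
  have "computable (\<lambda>x. rec_nat 0 (\<lambda>_ r. f x + r) (g x))"
    by (intro comp_intros computable_comp[OF assms(1)] assms)
  moreover have "rec_nat 0 (\<lambda>_ r. m + r) n = m * n" for m n :: nat
    by (induction n) auto
  ultimately show ?thesis by simp
qed

lemma computable_power [comp_intros]:
  assumes "computable f" "computable g"
  shows "computable (\<lambda>x. f x ^ g x)"
proof -
  have "computable (\<lambda>x. rec_nat 1 (\<lambda>_ r. f x * r) (g x))"
    by (intro comp_intros computable_comp[OF assms(1)] assms)
  moreover have "rec_nat 1 (\<lambda>_ r. m * r) n = m ^ n" for m n :: nat
    by (induction n) auto
  ultimately show ?thesis by (simp only:)
qed

section \<open>Unbounded search\<close>

lemma ce_search: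
  assumes "decidable {z. P (pi1 z) (pi2 z)}"
  obtains c where "\<And>x. eval c x = (if \<exists>n. P x n then Some (LEAST n. P x n) else None)"
proof -
  have "computable (\<lambda>z. if P (pi1 z) (pi2 z) then 0 else 1)"
    by (intro comp_intros assms)
  then obtain c where c: "\<forall>z. eval c z = Some (if P (pi1 z) (pi2 z) then 0 else 1)"
    unfolding computable_def by blast
  \<comment> \<open>The searched program is total, so the definedness condition in the
    \<open>CMu\<close> clause holds automatically.\<close>
  have "eval (CMu c) x = (if \<exists>n. P x n then Some (LEAST n. P x n) else None)" for x
    by (simp add: c)
  then show ?thesis using that by blast
qed

lemma computable_Least [comp_intros]:
  assumes "decidable {z. P (pi1 z) (pi2 z)}" "\<And>x. \<exists>n. P x n"
  shows "computable (\<lambda>x. LEAST n. P x n)"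
proof -
  obtain c where "\<And>x. eval c x = (if \<exists>n. P x n then Some (LEAST n. P x n) else None)"
    using ce_search[OF assms(1)] by blast
  then show ?thesis unfolding computable_def using assms(2) by auto
qed

lemma computable_div [comp_intros]:
  assumes "computable f" "computable g"
  shows "computable (\<lambda>x. f x div g x)"
proof -
  \<comment> \<open>The quotient is the least \<open>q\<close> whose successor multiple exceeds the
    dividend. The disjunct \<open>pi2 z = 0\<close> makes the search stop at 0, which agrees with
    division by zero in HOL.\<close>
  have "computable (\<lambda>z. LEAST q. pi2 z = 0 \<or> pi1 z < pi2 z * Suc q)"
  proof (intro comp_intros)
    fix z
    show "\<exists>q. pi2 z = 0 \<or> pi1 z < pi2 z * Suc q"
      by (metis bot_nat_0.not_eq_extremum dividend_less_times_div mult_Suc_right)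
  qed
  moreover have "(LEAST q. n = 0 \<or> m < n * Suc q) = (if n = 0 then 0 else m div n)" for m n :: nat
  proof (cases "n = 0")
    case False
    then have "m < n * Suc q \<longleftrightarrow> m div n \<le> q" for q
      by (metis bot_nat_0.not_eq_extremum div_less_iff_less_mult less_Suc_eq_le mult.commute)
    then show ?thesis using False by (simp add: Least_equality)
  qed (simp add: Least_equality)
  ultimately have "computable (\<lambda>z. if pi2 z = 0 then 0 else pi1 z div pi2 z)" by simp
  from computable_comp[OF this computable_pair[OF assms]]
  show ?thesis by (rule computable_cong) auto
qed

lemma computable_mod [comp_intros]:
  assumes "computable f" "computable g"
  shows "computable (\<lambda>x. f x mod g x)"
  unfolding minus_div_mult_eq_mod[symmetric] by (intro comp_intros assms)

section \<open>Binary codes of finite sets and bounded quantifiers\<close>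

lemma decidable_set_decode [comp_intros]:
  assumes "computable f" "computable g"
  shows "decidable {x. f x \<in> set_decode (g x)}"
proof -
  have "decidable {x. g x div 2 ^ f x mod 2 = 1}"
    by (intro comp_intros assms)
  then show ?thesis by (simp add: set_decode_def odd_iff_mod_2_eq_one)
qed

text \<open>Primitive recursion up to the bound accumulates the truth value of the
  conjunction.\<close>

lemma decidable_all_less [comp_intros]:
  assumes "computable f" "decidable {z. P (pi1 z) (pi2 z)}"
  shows "decidable {x. \<forall>m<f x. P x m}"
proof (rule decidableI)
  have "decidable {z. P (pi1 z) (pi1 (pi2 z))}"
    using decidable_comp[OF assms(2), of "\<lambda>z. pair (pi1 z) (pi1 (pi2 z))"]
    by (simp add: comp_intros)
  then have "computable (\<lambda>x. rec_nat 1 (\<lambda>m r. if P x m then r else 0) (f x))"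
    by (intro comp_intros assms)
  moreover have "rec_nat 1 (\<lambda>m r. if P x m then r else 0) n = (if \<forall>m<n. P x m then 1 else (0::nat))"
    for x n by (induction n) (auto simp: less_Suc_eq)
  ultimately show "computable (\<lambda>x. if \<forall>m<f x. P x m then 1 else 0)" by (simp only:)
qed

lemma decidable_ex_less [comp_intros]:
  assumes "computable f" "decidable {z. P (pi1 z) (pi2 z)}"
  shows "decidable {x. \<exists>m<f x. P x m}"
  using decidable_not[OF decidable_all_less[OF assms(1) decidable_not[OF assms(2)]]] by simp

section \<open>The arithmetical hierarchy\<close>

lemma Pi0_eq_Compl: "A \<in> Pi0 n \<longleftrightarrow> - A \<in> Sigma0 n"
proof (induction n arbitrary: A)
  case 0
  have "decidable (- A)" if "decidable A" for A
    using decidable_not[of "\<lambda>x. x \<in> A"] that by (simp add: Compl_eq)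
  then show ?case by (metis Pi0.simps(1) Sigma0.simps(1) double_compl mem_Collect_eq)
next
  case (Suc n)
  have *: "B \<in> Sigma0 n \<longleftrightarrow> - B \<in> Pi0 n" for B by (simp add: Suc)
  show ?case
  proof
    assume "A \<in> Pi0 (Suc n)"
    then obtain B where "B \<in> Sigma0 n" "A = {x. \<forall>a. pair x a \<in> B}" by auto
    then show "- A \<in> Sigma0 (Suc n)" by (auto simp: * intro!: exI[of _ "- B"])
  next
    assume "- A \<in> Sigma0 (Suc n)"
    then obtain B where "B \<in> Pi0 n" "- A = {x. \<exists>a. pair x a \<in> B}" by auto
    then have "- B \<in> Sigma0 n" "A = {x. \<forall>a. pair x a \<in> - B}" by (auto simp: Suc)
    then show "A \<in> Pi0 (Suc n)" by (auto intro!: exI[of _ "- B"])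
  qed
qed

lemma Sigma0_not: "{x. \<not> P x} \<in> Sigma0 n \<longleftrightarrow> {x. P x} \<in> Pi0 n"
  by (simp add: Pi0_eq_Compl Compl_eq)

text \<open>The two claims go by one simultaneous induction, since the matrix of a set lies in the
  dual class one level lower. There \<open>f\<close> acts on the first coordinate only and the
  quantified one is kept.\<close>

lemma Sigma0_comp: "{x. P x} \<in> Sigma0 n \<Longrightarrow> computable f \<Longrightarrow> {x. P (f x)} \<in> Sigma0 n"
  and Pi0_comp: "{x. P x} \<in> Pi0 n \<Longrightarrow> computable f \<Longrightarrow> {x. P (f x)} \<in> Pi0 n"
proof (induction n arbitrary: P f)
  case 0
  { case 1 then show ?case by (simp add: decidable_comp) }
  { case 2 then show ?case by (simp add: decidable_comp) }
next
  case (Suc n)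
  have f: "computable (\<lambda>z. pair (f (pi1 z)) (pi2 z))" if "computable f" for f
    by (intro comp_intros computable_comp[OF that])
  { case 1
    then obtain B where B: "B \<in> Pi0 n" "\<And>x. P x \<longleftrightarrow> (\<exists>a. pair x a \<in> B)" by auto
    have "{z. pair (f (pi1 z)) (pi2 z) \<in> B} \<in> Pi0 n"
      by (rule Suc(2)) (use B f[OF 1(2)] in auto)
    then show ?case by (auto simp: B intro!: exI[of _ "{z. pair (f (pi1 z)) (pi2 z) \<in> B}"]) }
  { case 2
    then obtain B where B: "B \<in> Sigma0 n" "\<And>x. P x \<longleftrightarrow> (\<forall>a. pair x a \<in> B)" by auto
    have "{z. pair (f (pi1 z)) (pi2 z) \<in> B} \<in> Sigma0 n"
      by (rule Suc(1)) (use B f[OF 2(2)] in auto)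
    then show ?case by (auto simp: B intro!: exI[of _ "{z. pair (f (pi1 z)) (pi2 z) \<in> B}"]) }
qed

lemma Sigma0_SucE:
  assumes "{x. P x} \<in> Sigma0 (Suc n)"
  obtains Q where "{z. Q (pi1 z) (pi2 z)} \<in> Pi0 n" "\<And>x. P x \<longleftrightarrow> (\<exists>a. Q x a)"
proof -
  obtain B where "B \<in> Pi0 n" "\<And>x. P x \<longleftrightarrow> (\<exists>a. pair x a \<in> B)" using assms by auto
  then show ?thesis by (intro that[of "\<lambda>x a. pair x a \<in> B"]) auto
qed

lemma Sigma0_SucI:
  assumes "{z. Q (pi1 z) (pi2 z)} \<in> Pi0 n"
  shows "{x. \<exists>a. Q x a} \<in> Sigma0 (Suc n)"
  using assms by (auto intro!: exI[of _ "{z. Q (pi1 z) (pi2 z)}"])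

lemma Pi0_SucI:
  assumes "{z. Q (pi1 z) (pi2 z)} \<in> Sigma0 n"
  shows "{x. \<forall>a. Q x a} \<in> Pi0 (Suc n)"
  using assms by (auto intro!: exI[of _ "{z. Q (pi1 z) (pi2 z)}"])

lemma Pi0_SucE:
  assumes "{x. P x} \<in> Pi0 (Suc n)"
  obtains Q where "{z. Q (pi1 z) (pi2 z)} \<in> Sigma0 n" "\<And>x. P x \<longleftrightarrow> (\<forall>a. Q x a)"
proof -
  obtain B where "B \<in> Sigma0 n" "\<And>x. P x \<longleftrightarrow> (\<forall>a. pair x a \<in> B)" using assms by auto
  then show ?thesis by (intro that[of "\<lambda>x a. pair x a \<in> B"]) auto
qed

text \<open>A dummy quantifier is put in front.\<close>

lemma Pi0_imp_Sigma0_Suc: "{x. P x} \<in> Pi0 n \<Longrightarrow> {x. P x} \<in> Sigma0 (Suc n)"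
  using Sigma0_SucI[of "\<lambda>x _. P x"] Pi0_comp[of P n pi1] computable_pi1[OF computable_id]
  by simp

lemma Sigma0_imp_Pi0_Suc: "{x. P x} \<in> Sigma0 n \<Longrightarrow> {x. P x} \<in> Pi0 (Suc n)"
  using Pi0_SucI[of "\<lambda>x _. P x"] Sigma0_comp[of P n pi1] computable_pi1[OF computable_id]
  by simp

lemma decidable_imp_Sigma0: "decidable {x. P x} \<Longrightarrow> {x. P x} \<in> Sigma0 n"
  and decidable_imp_Pi0: "decidable {x. P x} \<Longrightarrow> {x. P x} \<in> Pi0 n"
  by (induction n) (use Pi0_imp_Sigma0_Suc Sigma0_imp_Pi0_Suc in auto)

text \<open>For existential prefixes a pair of witnesses is coded as one number; universal
  quantifiers distribute over the conjunction.\<close>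

lemma Sigma0_and: "{x. P x} \<in> Sigma0 n \<Longrightarrow> {x. Q x} \<in> Sigma0 n \<Longrightarrow> {x. P x \<and> Q x} \<in> Sigma0 n"
  and Pi0_and: "{x. P x} \<in> Pi0 n \<Longrightarrow> {x. Q x} \<in> Pi0 n \<Longrightarrow> {x. P x \<and> Q x} \<in> Pi0 n"
proof (induction n arbitrary: P Q)
  case 0
  { case 1 then show ?case by (simp add: decidable_and) }
  { case 2 then show ?case by (simp add: decidable_and) }
next
  case (Suc n)
  { case 1
    obtain P' where P': "{z. P' (pi1 z) (pi2 z)} \<in> Pi0 n" "\<And>x. P x \<longleftrightarrow> (\<exists>a. P' x a)"
      using Sigma0_SucE[OF 1(1)] by blast
    obtain Q' where Q': "{z. Q' (pi1 z) (pi2 z)} \<in> Pi0 n" "\<And>x. Q x \<longleftrightarrow> (\<exists>a. Q' x a)"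
      using Sigma0_SucE[OF 1(2)] by blast
    have "{z. P' (pi1 z) (pi1 (pi2 z))} \<in> Pi0 n" "{z. Q' (pi1 z) (pi2 (pi2 z))} \<in> Pi0 n"
      using Pi0_comp[OF P'(1), of "\<lambda>z. pair (pi1 z) (pi1 (pi2 z))"]
        Pi0_comp[OF Q'(1), of "\<lambda>z. pair (pi1 z) (pi2 (pi2 z))"] by (simp_all add: comp_intros)
    then have "{x. \<exists>a. P' x (pi1 a) \<and> Q' x (pi2 a)} \<in> Sigma0 (Suc n)"
      by (intro Sigma0_SucI Suc(2))
    moreover have "(\<exists>a. P' x (pi1 a) \<and> Q' x (pi2 a)) \<longleftrightarrow> P x \<and> Q x" for x
      by (simp add: P' Q' ex_pair[of "\<lambda>a b. P' x a \<and> Q' x b"])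
    ultimately show ?case by simp }
  { case 2
    obtain P' where P': "{z. P' (pi1 z) (pi2 z)} \<in> Sigma0 n" "\<And>x. P x \<longleftrightarrow> (\<forall>a. P' x a)"
      using Pi0_SucE[OF 2(1)] by blast
    obtain Q' where Q': "{z. Q' (pi1 z) (pi2 z)} \<in> Sigma0 n" "\<And>x. Q x \<longleftrightarrow> (\<forall>a. Q' x a)"
      using Pi0_SucE[OF 2(2)] by blast
    have "{x. \<forall>a. P' x a \<and> Q' x a} \<in> Pi0 (Suc n)"
      by (intro Pi0_SucI Suc(1) P' Q')
    then show ?case by (simp add: P' Q' all_conj_distrib) }
qed

lemma Sigma0_or: "{x. P x} \<in> Sigma0 n \<Longrightarrow> {x. Q x} \<in> Sigma0 n \<Longrightarrow> {x. P x \<or> Q x} \<in> Sigma0 n"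
  using Pi0_and[of "\<lambda>x. \<not> P x" n "\<lambda>x. \<not> Q x"] by (simp flip: Sigma0_not)

text \<open>The new quantifier is contracted with the leading one of the matrix by pairing.\<close>

lemma Sigma0_ex:
  assumes "{z. P (pi1 z) (pi2 z)} \<in> Sigma0 (Suc n)"
  shows "{x. \<exists>a. P x a} \<in> Sigma0 (Suc n)"
proof -
  obtain Q where Q: "{w. Q (pi1 w) (pi2 w)} \<in> Pi0 n" "\<And>z. P (pi1 z) (pi2 z) \<longleftrightarrow> (\<exists>b. Q z b)"
    using Sigma0_SucE[OF assms] by blast
  have "{x. \<exists>a. Q (pair x (pi1 a)) (pi2 a)} \<in> Sigma0 (Suc n)"
    using Pi0_comp[OF Q(1), of "\<lambda>w. pair (pair (pi1 w) (pi1 (pi2 w))) (pi2 (pi2 w))"]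
    by (intro Sigma0_SucI) (simp add: comp_intros)
  moreover have "(\<exists>a. Q (pair x (pi1 a)) (pi2 a)) \<longleftrightarrow> (\<exists>a. P x a)" for x
    using Q(2)[of "pair x a" for a] by (simp add: ex_pair[of "\<lambda>a. Q (pair x a)"])
  ultimately show ?thesis by simp
qed

text \<open>Bounded collection: finitely many witnesses have a common bound \<open>b\<close>, which
  can be quantified first and leaves a decidable matrix.\<close>

lemma Sigma0_all_less:
  assumes "computable f" "{z. P (pi1 z) (pi2 z)} \<in> Sigma0 1"
  shows "{x. \<forall>m<f x. P x m} \<in> Sigma0 1"
proof -
  obtain Q where Q: "{w. Q (pi1 w) (pi2 w)} \<in> Pi0 0" "\<And>z. P (pi1 z) (pi2 z) \<longleftrightarrow> (\<exists>b. Q z b)"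
    using Sigma0_SucE[OF assms(2)[unfolded One_nat_def]] by blast
  have "decidable {w. Q (pair (pi1 (pi1 (pi1 w))) (pi2 (pi1 w))) (pi2 w)}"
    using decidable_comp[of "\<lambda>w. Q (pi1 w) (pi2 w)"
        "\<lambda>w. pair (pair (pi1 (pi1 (pi1 w))) (pi2 (pi1 w))) (pi2 w)"] Q(1)
    by (simp add: comp_intros)
  then have "{x. \<exists>b. \<forall>m<f x. \<exists>c<b. Q (pair x m) c} \<in> Sigma0 (Suc 0)"
    by (intro Sigma0_SucI)
       (auto intro!: comp_intros computable_comp[OF assms(1)])
  moreover have "(\<exists>b. \<forall>m<n. \<exists>c<b. Q (pair x m) c) \<longleftrightarrow> (\<forall>m<n. P x m)" for x n
  proof
    assume "\<forall>m<n. P x m"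
    then have "\<forall>m<n. \<exists>c. Q (pair x m) c" using Q(2)[of "pair x _"] by simp
    then obtain g where g: "\<forall>m<n. Q (pair x m) (g m)" by metis
    have "g m < Suc (Max (g ` {..<n}))" if "m < n" for m
      using that by (simp add: less_Suc_eq_le)
    then show "\<exists>b. \<forall>m<n. \<exists>c<b. Q (pair x m) c" using g by blast
  qed (use Q(2)[of "pair x _"] in auto)
  ultimately show ?thesis by simp
qed

lemma Sigma0_not_Suc: "{x. P x} \<in> Sigma0 n \<Longrightarrow> {x. \<not> P x} \<in> Sigma0 (Suc n)"
  by (rule Pi0_imp_Sigma0_Suc) (simp flip: Sigma0_not)

lemma Sigma0_mono: "A \<in> Sigma0 n \<Longrightarrow> A \<in> Sigma0 (Suc n)"
  and Pi0_mono: "A \<in> Pi0 n \<Longrightarrow> A \<in> Pi0 (Suc n)"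
proof (induction n arbitrary: A)
  case 0
  { case 1 then show ?case using Pi0_imp_Sigma0_Suc[of "\<lambda>x. x \<in> A" 0] by simp }
  { case 2 then show ?case using Sigma0_imp_Pi0_Suc[of "\<lambda>x. x \<in> A" 0] by simp }
next
  case (Suc n)
  { case 1
    then obtain B where B: "B \<in> Pi0 n" "A = {x. \<exists>a. pair x a \<in> B}" by auto
    from Suc(2)[OF B(1)] show ?case unfolding B(2) Sigma0.simps(2)[of "Suc n"] by blast }
  { case 2
    then obtain B where B: "B \<in> Sigma0 n" "A = {x. \<forall>a. pair x a \<in> B}" by auto
    from Suc(1)[OF B(1)] show ?case unfolding B(2) Pi0.simps(2)[of "Suc n"] by blast }
qed

named_theorems sigma_intros

declare Sigma0_ex [sigma_intros] Sigma0_and [sigma_intros] Sigma0_or [sigma_intros]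
  Sigma0_not_Suc [sigma_intros]

section \<open>A universal derivation predicate\<close>

text \<open>
  A computation is recorded as a finite set of triples, to be read as \<open>decode e\<close> maps \<open>x\<close>
  to \<open>y\<close>.  No order on the set is needed: every triple is justified by triples with smaller
  \<open>e\<close>, or with the same \<open>e\<close> and a shorter recursion.
\<close>

abbreviation triple :: "nat \<Rightarrow> nat \<Rightarrow> nat \<Rightarrow> nat" where
  "triple e x y \<equiv> pair e (pair x y)"

text \<open>One clause per constructor, with the index arithmetic of \<open>decode\<close>. Only the
  \<open>CPrec\<close> clause refers back to \<open>e\<close> itself, at a smaller recursion
  argument. In the \<open>CMu\<close> clause every earlier value must be witnessed as a successor,
  that is, defined and nonzero.\<close>

definition justified :: "nat set \<Rightarrow> nat \<Rightarrow> nat \<Rightarrow> nat \<Rightarrow> bool" where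
  "justified A e x y \<longleftrightarrow>
     (if e = 0 then y = 0
      else if e = 1 then y = Suc x
      else if e = 2 then y = pi1 x
      else if e = 3 then y = pi2 x
      else if e mod 4 = 0 then
        triple (pi1 ((e - 4) div 4)) x (pi1 y) \<in> A \<and> triple (pi2 ((e - 4) div 4)) x (pi2 y) \<in> A
      else if e mod 4 = 1 then
        \<exists>z. triple (pi2 ((e - 4) div 4)) x z \<in> A \<and> triple (pi1 ((e - 4) div 4)) z y \<in> A
      else if e mod 4 = 2 then
        (if pi2 x = 0 then triple (pi1 ((e - 4) div 4)) (pi1 x) y \<in> A
         else \<exists>r. triple e (pair (pi1 x) (pi2 x - 1)) r \<in> A \<and>
                triple (pi2 ((e - 4) div 4)) (pair (pi1 x) (pair (pi2 x - 1) r)) y \<in> A)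
      else triple ((e - 4) div 4) (pair x y) 0 \<in> A \<and>
        (\<forall>m<y. \<exists>r. triple ((e - 4) div 4) (pair x m) (Suc r) \<in> A))"

lemma justified_simps:
  "justified A 0 x y \<longleftrightarrow> y = 0"
  "justified A (Suc 0) x y \<longleftrightarrow> y = Suc x"
  "justified A 2 x y \<longleftrightarrow> y = pi1 x"
  "justified A 3 x y \<longleftrightarrow> y = pi2 x"
  "justified A (4 * pair a b + 4) x y \<longleftrightarrow> triple a x (pi1 y) \<in> A \<and> triple b x (pi2 y) \<in> A"
  "justified A (4 * pair a b + 5) x y \<longleftrightarrow> (\<exists>z. triple b x z \<in> A \<and> triple a z y \<in> A)"
  "justified A (4 * pair a b + 6) (pair u 0) y \<longleftrightarrow> triple a u y \<in> A"
  "justified A (4 * pair a b + 6) (pair u (Suc n)) y \<longleftrightarrow>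
    (\<exists>r. triple (4 * pair a b + 6) (pair u n) r \<in> A \<and> triple b (pair u (pair n r)) y \<in> A)"
  "justified A (4 * k + 7) x y \<longleftrightarrow>
    triple k (pair x y) 0 \<in> A \<and> (\<forall>m<y. \<exists>r. triple k (pair x m) (Suc r) \<in> A)"
proof -
  have "(4 * m + 5 - 4) div 4 = m" "(4 * m + 6 - 4) div 4 = m" "(4 * m + 7 - 4) div 4 = m"
    "(4 * m + 5) mod 4 = 1" "(4 * m + 6) mod 4 = 2" "(4 * m + 7) mod 4 = 3" for m :: nat
    by presburger+
  note eqs = this
  show "justified A 0 x y \<longleftrightarrow> y = 0"
    "justified A (Suc 0) x y \<longleftrightarrow> y = Suc x"
    "justified A 2 x y \<longleftrightarrow> y = pi1 x"
    "justified A 3 x y \<longleftrightarrow> y = pi2 x"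
    "justified A (4 * pair a b + 4) x y \<longleftrightarrow> triple a x (pi1 y) \<in> A \<and> triple b x (pi2 y) \<in> A"
    unfolding justified_def by simp_all
  show "justified A (4 * pair a b + 5) x y \<longleftrightarrow> (\<exists>z. triple b x z \<in> A \<and> triple a z y \<in> A)"
    "justified A (4 * pair a b + 6) (pair u 0) y \<longleftrightarrow> triple a u y \<in> A"
    "justified A (4 * pair a b + 6) (pair u (Suc n)) y \<longleftrightarrow>
      (\<exists>r. triple (4 * pair a b + 6) (pair u n) r \<in> A \<and> triple b (pair u (pair n r)) y \<in> A)"
    "justified A (4 * k + 7) x y \<longleftrightarrow>
      triple k (pair x y) 0 \<in> A \<and> (\<forall>m<y. \<exists>r. triple k (pair x m) (Suc r) \<in> A)"
    unfolding justified_def by (simp_all only: eqs prod_encode_inverse fst_conv snd_conv) simp_all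
qed

lemma index_cases:
  obtains "e = 0" | "e = 1" | "e = 2" | "e = 3"
    | a b where "e = 4 * pair a b + 4" | a b where "e = 4 * pair a b + 5"
    | a b where "e = 4 * pair a b + 6" | k where "e = 4 * k + (7 :: nat)"
proof -
  have "e < 4 \<or> (\<exists>k. e = 4 * k + 4 \<or> e = 4 * k + 5 \<or> e = 4 * k + 6 \<or> e = 4 * k + 7)"
    by presburger
  then consider "e < 4" | k where "e = 4 * k + 4" | k where "e = 4 * k + 5"
    | k where "e = 4 * k + 6" | k where "e = 4 * k + 7"
    by blast
  then show ?thesis
  proof cases
    case 1
    then have "e = 0 \<or> e = 1 \<or> e = 2 \<or> e = 3" by presburger
    then show ?thesis using that by blast
  next
    case (2 k) then show ?thesis using that(5)[of "pi1 k" "pi2 k"] by simp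
  next
    case (3 k) then show ?thesis using that(6)[of "pi1 k" "pi2 k"] by simp
  next
    case (4 k) then show ?thesis using that(7)[of "pi1 k" "pi2 k"] by simp
  next
    case (5 k) then show ?thesis using that(8) by blast
  qed
qed

text \<open>Subprograms have smaller indices, so induction on \<open>e\<close> can replace induction
  on programs.\<close>

lemma index_less:
  "a < 4 * pair a b + 4" "b < 4 * pair a b + 4" "a < 4 * pair a b + 5" "b < 4 * pair a b + 5"
  "a < 4 * pair a b + 6" "b < 4 * pair a b + 6" "k < 4 * k + (7 :: nat)"
  using le_prod_encode_1[of a b] le_prod_encode_2[of b a] by linarith+

definition derivation :: "nat set \<Rightarrow> bool" where
  "derivation A \<longleftrightarrow> (\<forall>w\<in>A. justified A (pi1 w) (pi1 (pi2 w)) (pi2 (pi2 w)))"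

lemma derivationD: "derivation A \<Longrightarrow> triple e x y \<in> A \<Longrightarrow> justified A e x y"
  unfolding derivation_def by fastforce

text \<open>\<open>A\<close> occurs only positively in the definition.\<close>

lemma justified_mono:
  assumes "justified A e x y" "A \<subseteq> B"
  shows "justified B e x y"
proof -
  have "P \<in> A \<Longrightarrow> P \<in> B" for P using assms(2) by blast
  then show ?thesis using assms(1) unfolding justified_def by (smt (verit))
qed

lemma derivation_Union:
  assumes "\<And>A. A \<in> \<A> \<Longrightarrow> derivation A"
  shows "derivation (\<Union>\<A>)"
  unfolding derivation_def
  by (metis UnionE Union_upper assms derivation_def justified_mono)

lemma derivation_Un: "derivation A \<Longrightarrow> derivation B \<Longrightarrow> derivation (A \<union> B)"
  using derivation_Union[of "{A, B}"] by auto

lemma derivation_insert: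
  assumes "derivation A" "justified A e x y"
  shows "derivation (insert (triple e x y) A)"
  unfolding derivation_def
proof
  fix w assume "w \<in> insert (triple e x y) A"
  then have "justified A (pi1 w) (pi1 (pi2 w)) (pi2 (pi2 w))"
    using assms by (auto simp: derivation_def)
  then show "justified (insert (triple e x y) A) (pi1 w) (pi1 (pi2 w)) (pi2 (pi2 w))"
    by (rule justified_mono) blast
qed

lemma derivation_sound:
  assumes "derivation A" "triple e x y \<in> A"
  shows "eval (decode e) x = Some y"
  using assms(2)
proof (induction e arbitrary: x y rule: less_induct)
  case (less e)
  have j: "justified A e x y" using derivationD[OF assms(1) less.prems] .
  show ?case
  proof (cases e rule: index_cases)
    case (5 a b)
    then show ?thesis
      using j less.IH[of a x "pi1 y"] less.IH[of b x "pi2 y"] index_less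
      by (simp add: justified_simps decode_eqs)
  next
    case (6 a b)
    then show ?thesis
      using j less.IH[of b x] less.IH[of a _ y] index_less
      by (auto simp: justified_simps decode_eqs)
  next
    case (7 a b)
    have ab: "a < e" "b < e" using index_less 7 by auto
    \<comment> \<open>The index stays \<open>e\<close> along a recursion, so the outer hypothesis
      does not apply to it; an inner induction on the recursion argument is needed.\<close>
    have "triple e (pair u n) y \<in> A \<Longrightarrow> eval (decode e) (pair u n) = Some y" for u n y
    proof (induction n arbitrary: y)
      case 0
      then show ?case
        using derivationD[OF assms(1) 0] less.IH[OF ab(1)] by (auto simp: 7 justified_simps decode_eqs)
    next
      case (Suc n)
      obtain r where r: "triple e (pair u n) r \<in> A" "triple b (pair u (pair n r)) y \<in> A"
        using derivationD[OF assms(1) Suc.prems] unfolding 7 justified_simps by blast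
      show ?case using Suc.IH[OF r(1)] less.IH[OF ab(2) r(2)] by (simp add: 7 decode_eqs)
    qed
    from this[of "pi1 x" "pi2 x" y] show ?thesis using less.prems by (simp only: pair_pi)
  next
    case (8 k)
    have k: "k < e" using 8 by simp
    have y: "eval (decode k) (pair x y) = Some 0"
      using j less.IH[OF k, of "pair x y" 0] by (simp add: 8 justified_simps)
    have m: "\<exists>r. eval (decode k) (pair x m) = Some (Suc r)" if "m < y" for m
      using j that less.IH[OF k, of "pair x m"] by (auto simp: 8 justified_simps)
    \<comment> \<open>All values below \<open>y\<close> are successors, so no zero occurs
      earlier.\<close>
    have "(LEAST n. eval (decode k) (pair x n) = Some 0) = y"
      by (rule Least_equality[of _ y]) (use y m in \<open>force simp: not_less[symmetric]\<close>)+
    moreover have "\<exists>n. eval (decode k) (pair x n) = Some 0 \<and> (\<forall>m<n. eval (decode k) (pair x m) \<noteq> None)"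
      using y m by (intro exI[of _ y]) auto
    ultimately show ?thesis by (simp add: 8 decode_eqs)
  qed (use j in \<open>simp_all add: justified_simps decode_eqs(1-4)[simplified]\<close>)
qed

text \<open>Finite derivations are closed under finite unions and under adding a justified triple,
  so those for the subcomputations can be merged and extended by the result.\<close>

lemma derivation_complete:
  assumes "eval (decode e) x = Some y"
  shows "\<exists>A. finite A \<and> derivation A \<and> triple e x y \<in> A"
proof -
  define derivable where "derivable e x y \<longleftrightarrow> (\<exists>A. finite A \<and> derivation A \<and> triple e x y \<in> A)" for e x y
  have derivableI: "derivable e x y" if "finite A" "derivation A" "justified A e x y" for A e x y
    unfolding derivable_def
    by (rule exI[of _ "insert (triple e x y) A"]) (use that derivation_insert in auto)
  have derivable2: "\<exists>A. finite A \<and> derivation A \<and> triple e x y \<in> A \<and> triple e' x' y' \<in> A"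
    if "derivable e x y" "derivable e' x' y'" for e x y e' x' y'
  proof -
    obtain A B where "finite A" "derivation A" "triple e x y \<in> A"
      "finite B" "derivation B" "triple e' x' y' \<in> B"
      using \<open>derivable e x y\<close> \<open>derivable e' x' y'\<close> unfolding derivable_def by blast
    then show ?thesis by (intro exI[of _ "A \<union> B"]) (simp add: derivation_Un)
  qed
  have base: "derivable e x y" if "justified {} e x y" for e x y
    by (rule derivableI[OF _ _ that]) (auto simp: derivation_def)
  have "derivable e x y" using assms
  proof (induction e arbitrary: x y rule: less_induct)
    case (less e)
    show ?case
    proof (cases e rule: index_cases)
      case (5 a b)
      obtain u v where uv: "eval (decode a) x = Some u" "eval (decode b) x = Some v" "y = pair u v"
        using less.prems by (auto simp: 5 decode_eqs bind_eq_Some_conv)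
      have "derivable a x u" "derivable b x v"
        using less.IH uv index_less 5 by auto
      then obtain A where "finite A" "derivation A" "triple a x u \<in> A" "triple b x v \<in> A"
        using derivable2[of a x u b x v] by blast
      then show ?thesis by (intro derivableI[of A]) (simp_all add: 5 justified_simps uv)
    next
      case (6 a b)
      obtain z where z: "eval (decode b) x = Some z" "eval (decode a) z = Some y"
        using less.prems by (auto simp: 6 decode_eqs bind_eq_Some_conv)
      have "derivable b x z" "derivable a z y"
        using less.IH z index_less 6 by auto
      then obtain A where "finite A" "derivation A" "triple b x z \<in> A" "triple a z y \<in> A"
        using derivable2[of b x z a z y] by blast
      then show ?thesis by (intro derivableI[of A]) (auto simp: 6 justified_simps)
    next
      case (7 a b)
      have ab: "a < e" "b < e" using index_less 7 by auto
      have "eval (decode e) (pair u n) = Some y \<Longrightarrow> derivable e (pair u n) y" for u n y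
      proof (induction n arbitrary: y)
        case 0
        then have "derivable a u y" using less.IH[OF ab(1)] by (simp add: 7 decode_eqs)
        then obtain A where "finite A" "derivation A" "triple a u y \<in> A"
          unfolding derivable_def by blast
        then show ?case by (intro derivableI[of A]) (simp_all add: 7 justified_simps)
      next
        case (Suc n)
        then obtain r where r: "eval (decode e) (pair u n) = Some r"
          "eval (decode b) (pair u (pair n r)) = Some y"
          by (auto simp: 7 decode_eqs bind_eq_Some_conv)
        obtain A where "finite A" "derivation A" "triple e (pair u n) r \<in> A"
          "triple b (pair u (pair n r)) y \<in> A"
          using derivable2[OF Suc.IH[OF r(1)] less.IH[OF ab(2) r(2)]] by blast
        then show ?case by (intro derivableI[of A]) (auto simp: 7 justified_simps)
      qed
      from this[of "pi1 x" "pi2 x" y] show ?thesis using less.prems by (simp only: pair_pi)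
    next
      case (8 k)
      have k: "k < e" using 8 by simp
      let ?P = "\<lambda>n. eval (decode k) (pair x n) = Some 0"
      obtain n where n: "?P n" "\<forall>m<n. eval (decode k) (pair x m) \<noteq> None" and y: "y = (LEAST n. ?P n)"
        using less.prems by (auto simp: 8 decode_eqs split: if_splits)
      \<comment> \<open>The \<open>n\<close> from the \<open>CMu\<close> clause need not be the
        least zero a priori; this inequality transfers definedness to all arguments below
        \<open>y\<close>.\<close>
      have "y \<le> n" unfolding y by (rule Least_le[of ?P, OF n(1)])
      have y0: "?P y" unfolding y by (rule LeastI[of ?P, OF n(1)])
      have "\<exists>r. derivable k (pair x m) (Suc r)" if "m < y" for m
      proof -
        have "m < n" using \<open>y \<le> n\<close> that by simp
        then obtain r where r: "eval (decode k) (pair x m) = Some r" using n(2) by blast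
        have "\<not> ?P m" using that unfolding y by (rule not_less_Least)
        then obtain r' where "r = Suc r'" using r by (cases r) auto
        then show ?thesis using less.IH[OF k r] by blast
      qed
      then have "\<forall>m. \<exists>A. m < y \<longrightarrow> finite A \<and> derivation A \<and> (\<exists>r. triple k (pair x m) (Suc r) \<in> A)"
        unfolding derivable_def by metis
      then obtain F where F: "\<And>m. m < y \<Longrightarrow> finite (F m)" "\<And>m. m < y \<Longrightarrow> derivation (F m)"
        "\<And>m. m < y \<Longrightarrow> \<exists>r. triple k (pair x m) (Suc r) \<in> F m"
        by metis
      obtain A where A: "finite A" "derivation A" "triple k (pair x y) 0 \<in> A"
        using less.IH[OF k y0] unfolding derivable_def by blast
      let ?B = "\<Union>(insert A (F ` {..<y}))"
      show ?thesis
      proof (rule derivableI[of ?B])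
        show "finite ?B" using A F by auto
        show "derivation ?B" by (rule derivation_Union) (use A F in auto)
        show "justified ?B e x y" unfolding 8 justified_simps using A F by fastforce
      qed
    qed (use less.prems in \<open>auto intro!: base simp: justified_simps decode_eqs(1-4)[simplified]
        \<close>)
  qed
  then show ?thesis unfolding derivable_def .
qed

section \<open>Finite derivations coded by numbers\<close>

lemma in_set_decode_less:
  assumes "m \<in> set_decode S"
  shows "m < S"
proof -
  have "S div 2 ^ m \<noteq> 0" using assms by (metis even_zero mem_Collect_eq set_decode_def)
  then have "2 ^ m \<le> S" by (simp add: div_eq_0_iff)
  then show ?thesis using less_exp[of m] by linarith
qed

lemma pair_in_set_decode_less:
  assumes "pair a b \<in> set_decode S"
  shows "a < S" "b < S"
  using in_set_decode_less[OF assms] le_prod_encode_1[of a b] le_prod_encode_2[of b a] by linarith+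

text \<open>Every witness sits inside a member of the coded set and is therefore below the code
  \<open>S\<close>. The existential quantifiers become bounded, which makes justification
  decidable.\<close>

lemma justified_set_decode:
  "justified (set_decode S) e x y \<longleftrightarrow>
     (if e = 0 then y = 0
      else if e = 1 then y = Suc x
      else if e = 2 then y = pi1 x
      else if e = 3 then y = pi2 x
      else if e mod 4 = 0 then
        triple (pi1 ((e - 4) div 4)) x (pi1 y) \<in> set_decode S \<and>
        triple (pi2 ((e - 4) div 4)) x (pi2 y) \<in> set_decode S
      else if e mod 4 = 1 then
        \<exists>z<S. triple (pi2 ((e - 4) div 4)) x z \<in> set_decode S \<and>
          triple (pi1 ((e - 4) div 4)) z y \<in> set_decode S
      else if e mod 4 = 2 then
        (if pi2 x = 0 then triple (pi1 ((e - 4) div 4)) (pi1 x) y \<in> set_decode S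
         else \<exists>r<S. triple e (pair (pi1 x) (pi2 x - 1)) r \<in> set_decode S \<and>
                triple (pi2 ((e - 4) div 4)) (pair (pi1 x) (pair (pi2 x - 1) r)) y \<in> set_decode S)
      else triple ((e - 4) div 4) (pair x y) 0 \<in> set_decode S \<and>
        (\<forall>m<y. \<exists>r<S. triple ((e - 4) div 4) (pair x m) (Suc r) \<in> set_decode S))"
proof -
  have less: "z < S" if "triple a b z \<in> set_decode S" for a b z
    using pair_in_set_decode_less(2)[OF that] le_prod_encode_2[of z b] by linarith
  have "(\<exists>z. triple a b z \<in> set_decode S \<and> Q z) \<longleftrightarrow>
      (\<exists>z<S. triple a b z \<in> set_decode S \<and> Q z)" for a b Q
    using less by blast
  moreover have "(\<exists>r. triple a b (Suc r) \<in> set_decode S) \<longleftrightarrow>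
      (\<exists>r<S. triple a b (Suc r) \<in> set_decode S)" for a b
    using less Suc_lessD by blast
  ultimately show ?thesis unfolding justified_def by (simp only:)
qed

lemma decidable_justified:
  "decidable {w. justified (set_decode (pi1 w)) (pi1 (pi2 w)) (pi1 (pi2 (pi2 w))) (pi2 (pi2 (pi2 w)))}"
  unfolding justified_set_decode by (intro comp_intros)

lemma decidable_derivation: "decidable {S. derivation (set_decode S)}"
proof -
  have "decidable {z. justified (set_decode (pi1 z)) (pi1 (pi2 z)) (pi1 (pi2 (pi2 z))) (pi2 (pi2 (pi2 z)))}"
    by (rule decidable_justified)
  then have "decidable {S. \<forall>w<S. w \<in> set_decode S \<longrightarrow>
      justified (set_decode S) (pi1 w) (pi1 (pi2 w)) (pi2 (pi2 w))}"
    by (intro comp_intros)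
  moreover have "(\<forall>w<S. w \<in> set_decode S \<longrightarrow> justified (set_decode S) (pi1 w) (pi1 (pi2 w)) (pi2 (pi2 w)))
      \<longleftrightarrow> derivation (set_decode S)" for S
    unfolding derivation_def using in_set_decode_less by blast
  ultimately show ?thesis by simp
qed

text \<open>A form of Kleene's normal form: evaluation is existential quantification over codes of
  finite derivations, with a decidable matrix. The level is left general so that the rule applies
  anywhere in a prefix.\<close>

lemma Sigma0_eval [sigma_intros]:
  assumes "computable f" "computable g" "computable h"
  shows "{w. eval (decode (f w)) (g w) = Some (h w)} \<in> Sigma0 (Suc n)"
proof -
  have eq: "eval (decode e) x = Some y \<longleftrightarrow>
      (\<exists>S. derivation (set_decode S) \<and> triple e x y \<in> set_decode S)" for e x y
    using derivation_sound derivation_complete[of e x y] by (metis set_encode_inverse)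
  show ?thesis
    unfolding eq
    by (intro Sigma0_SucI decidable_imp_Pi0 comp_intros decidable_comp[OF decidable_derivation]
        computable_comp[OF assms(1)] computable_comp[OF assms(2)] computable_comp[OF assms(3)])
qed

lemma mem_W_iff: "x \<in> W e \<longleftrightarrow> (\<exists>y. eval (decode e) x = Some y)"
  unfolding W_def by auto

lemma Sigma0_mem_W [sigma_intros]:
  assumes "computable f" "computable g"
  shows "{w. g w \<in> W (f w)} \<in> Sigma0 (Suc n)"
  unfolding mem_W_iff
  by (intro sigma_intros computable_comp[OF assms(1)] computable_comp[OF assms(2)] comp_intros)

section \<open>Parametrization (s-m-n) and uniform c.e. indices\<close>

lemma eval_partial_apply:
  obtains k where "computable k" "\<And>x y. eval (decode (k x)) y = eval c (pair x y)"
proof -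
  \<comment> \<open>\<open>k0 x\<close> indexes the constant function \<open>x\<close>: index 0 is
    \<open>CZero\<close>, and \<open>4 * pair 1 r + 5\<close> composes \<open>CSucc\<close> with
    program \<open>r\<close>.\<close>
  define k0 where "k0 x = rec_nat 0 (\<lambda>_ r. 4 * pair 1 r + 5) x" for x :: nat
  have "computable k0" unfolding k0_def by (intro comp_intros)
  have k0: "eval (decode (k0 x)) y = Some x" for x y
    by (induction x) (simp_all add: k0_def decode_eqs decode_eqs(2)[simplified])
  obtain i where i: "decode i = CPair CFst CSnd" using surj_decode by (metis surj_def)
  obtain d where d: "decode d = c" using surj_decode by (metis surj_def)
  define k where "k x = 4 * pair d (4 * pair (k0 x) i + 4) + 5" for x
  have "computable k" unfolding k_def by (intro comp_intros \<open>computable k0\<close>)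
  moreover have "eval (decode (k x)) y = eval c (pair x y)" for x y
    by (simp add: k_def decode_eqs k0 i d)
  ultimately show ?thesis using that by blast
qed

text \<open>The search program for a witness has the c.e. set as its domain; freezing the first
  argument by s-m-n gives the indices uniformly.\<close>

lemma ce_index:
  assumes "{z. P (pi1 z) (pi2 z)} \<in> Sigma0 (Suc 0)"
  shows "\<exists>k. computable k \<and> (\<forall>x. W (k x) = {y. P x y})"
proof -
  obtain Q where Q: "decidable {w. Q (pi1 w) (pi2 w)}" "\<And>z. P (pi1 z) (pi2 z) \<longleftrightarrow> (\<exists>b. Q z b)"
    using Sigma0_SucE[OF assms] by auto
  obtain c where c: "\<And>z. eval c z = (if \<exists>n. Q z n then Some (LEAST n. Q z n) else None)"
    using ce_search[OF Q(1)] by blast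
  obtain k where k: "computable k" "\<And>x y. eval (decode (k x)) y = eval c (pair x y)"
    using eval_partial_apply by blast
  have "W (k x) = {y. P x y}" for x
    using Q(2)[of "pair x y" for y] by (auto simp: mem_W_iff k c split: if_splits)
  then show ?thesis using k by blast
qed

lemma ce_if_Sigma0:
  assumes "{x. P x} \<in> Sigma0 (Suc 0)"
  shows "ce {x. P x}"
proof -
  have "{z. P (pi2 z)} \<in> Sigma0 (Suc 0)"
    by (rule Sigma0_comp[OF assms]) (intro comp_intros)
  from ce_index[of "\<lambda>_. P", OF this] obtain k :: "nat \<Rightarrow> nat" where W: "\<And>x. W (k x) = {y. P y}"
    by blast
  from W[of 0] show ?thesis unfolding ce_def W_def by (intro exI[of _ "decode (k 0)"]) simp
qed

section \<open>Ceers\<close>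

lemma Sigma0_rtrancl:
  assumes "{w. Q (pi1 w) (pi1 (pi2 w)) (pi2 (pi2 w))} \<in> Sigma0 (Suc 0)"
  shows "{w. (pi1 (pi2 w), pi2 (pi2 w)) \<in> {(u, v). Q (pi1 w) u v}\<^sup>*} \<in> Sigma0 (Suc 0)"
proof -
  \<comment> \<open>\<open>A\<close> collects codes of \<open>(i, u)\<close> saying that
    \<open>u\<close> is reached from \<open>x\<close> in \<open>i\<close> steps, and each member
    needs a predecessor in \<open>A\<close>. The counter rules out cycles of elements that justify
    only one another.\<close>
  define step where "step z x A w \<longleftrightarrow> w \<notin> A \<or> w = pair 0 x \<or>
      (\<exists>i u. pi1 w = Suc i \<and> pair i u \<in> A \<and> Q z u (pi2 w))" for z x A w
  have "(x, y) \<in> {(u, v). Q z u v}\<^sup>*" if st: "\<And>w. step z x A w" and "pair n y \<in> A" for z x y A n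
    using that(2)
  proof (induction n arbitrary: y)
    case 0
    then show ?case using st[of "pair 0 y"] by (simp add: step_def)
  next
    case (Suc n)
    then obtain u where "pair n u \<in> A" "Q z u y"
      using st[of "pair (Suc n) y"] by (auto simp: step_def)
    then show ?case using Suc.IH[of u] by (simp add: rtrancl.rtrancl_into_rtrancl)
  qed
  moreover have "\<exists>A n. finite A \<and> (\<forall>w. step z x A w) \<and> pair n y \<in> A"
    if "(x, y) \<in> {(u, v). Q z u v}\<^sup>*" for z x y
    using that
  proof (induction rule: rtrancl_induct)
    case base
    show ?case by (rule exI[of _ "{pair 0 x}"]) (auto simp: step_def)
  next
    case (step u v)
    then obtain A n where A: "finite A" "\<And>w. step z x A w" "pair n u \<in> A" by blast
    have "step z x (insert (pair (Suc n) v) A) w" for w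
      using A(2)[of w] A(3) step.hyps(2) unfolding step_def by auto
    then show ?case using A(1) by blast
  qed
  \<comment> \<open>Numbers from \<open>S\<close> on are outside \<open>set_decode S\<close> and
    satisfy \<open>step\<close> trivially, so a bounded quantifier suffices.\<close>
  ultimately have "(x, y) \<in> {(u, v). Q z u v}\<^sup>* \<longleftrightarrow>
      (\<exists>S n. (\<forall>w<S. step z x (set_decode S) w) \<and> pair n y \<in> set_decode S)" for x y z
    using in_set_decode_less step_def by (smt (verit, best) set_encode_inverse)
  moreover have "{w. \<exists>S n. (\<forall>t<S. step (pi1 w) (pi1 (pi2 w)) (set_decode S) t) \<and>
      pair n (pi2 (pi2 w)) \<in> set_decode S} \<in> Sigma0 (Suc 0)"
  proof -
    have Q: "{w. Q (f w) (g w) (h w)} \<in> Sigma0 (Suc 0)"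
      if "computable f" "computable g" "computable h" for f g h
      using Sigma0_comp[OF assms, of "\<lambda>w. pair (f w) (pair (g w) (h w))"] that
      by (simp add: comp_intros)
    show ?thesis
      unfolding step_def
      by (intro sigma_intros Sigma0_all_less[unfolded One_nat_def] Q comp_intros
          decidable_imp_Sigma0[OF decidable_set_decode] decidable_imp_Sigma0[OF decidable_eq]
          decidable_imp_Sigma0[OF decidable_not[OF decidable_set_decode]])
  qed
  ultimately show ?thesis by (simp only:)
qed

lemma std_ceer_eq: "std_ceer z = {(u, v). pair u v \<in> W z \<or> pair v u \<in> W z}\<^sup>*"
proof -
  have "{(u, v). pair u v \<in> W z \<or> pair v u \<in> W z} = {(x, y). pair x y \<in> W z} \<union> {(x, y). pair x y \<in> W z}\<inverse>"
    by auto
  then show ?thesis unfolding std_ceer_def Let_def by simp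
qed

lemma Sigma0_std_ceer1:
  assumes "computable f" "computable g" "computable h"
  shows "{w. (f w, g w) \<in> std_ceer (h w)} \<in> Sigma0 (Suc 0)"
proof -
  have "{w. (pi1 (pi2 w), pi2 (pi2 w)) \<in> std_ceer (pi1 w)} \<in> Sigma0 (Suc 0)"
    unfolding std_ceer_eq by (intro Sigma0_rtrancl sigma_intros comp_intros)
  from Sigma0_comp[OF this, of "\<lambda>w. pair (h w) (pair (f w) (g w))"]
  show ?thesis using assms by (simp add: comp_intros)
qed

lemma Sigma0_std_ceer [sigma_intros]:
  assumes "computable f" "computable g" "computable h"
  shows "{w. (f w, g w) \<in> std_ceer (h w)} \<in> Sigma0 (Suc n)"
  by (induction n) (fact Sigma0_std_ceer1[OF assms], rule Sigma0_mono)

lemma ceer_std_ceer: "ceer (std_ceer z)"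
  unfolding ceer_def
proof
  have "sym (std_ceer z)"
    unfolding std_ceer_eq by (rule sym_rtrancl) (auto simp: sym_def)
  then show "equiv UNIV (std_ceer z)"
    by (intro equivI) (auto simp: std_ceer_eq refl_on_def trans_rtrancl)
  have "ce {w. (pi1 w, pi2 w) \<in> std_ceer z}"
    by (intro ce_if_Sigma0 sigma_intros comp_intros)
  moreover have "prod_encode ` std_ceer z = {w. (pi1 w, pi2 w) \<in> std_ceer z}"
    by (auto simp: image_iff) (metis prod.collapse prod_decode_inverse)
  ultimately show "ce (prod_encode ` std_ceer z)" by simp
qed

text \<open>\<open>w\<close> packs a program index with a target \<open>j\<close>. Outputs are named
  by existential quantifiers, so totality is not presumed and every atom stays
  \<open>Sigma0 1\<close>.\<close>

lemma self_full_std_ceer_iff: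
  "self_full (std_ceer z) \<longleftrightarrow> (\<forall>w.
     (\<exists>x. \<not> (\<exists>u. eval (decode (pi1 w)) x = Some u)) \<or>
     (\<exists>x y u v. eval (decode (pi1 w)) x = Some u \<and> eval (decode (pi1 w)) y = Some v \<and>
        ((x, y) \<in> std_ceer z \<and> (u, v) \<notin> std_ceer z \<or> (x, y) \<notin> std_ceer z \<and> (u, v) \<in> std_ceer z)) \<or>
     (\<exists>k u. eval (decode (pi1 w)) k = Some u \<and> (u, pi2 w) \<in> std_ceer z))"
    (is "_ \<longleftrightarrow> (\<forall>w. ?A w \<or> ?B w \<or> ?C w)")
proof
  assume sf: "self_full (std_ceer z)"
  show "\<forall>w. ?A w \<or> ?B w \<or> ?C w"
  proof (intro allI disjCI)
    fix w assume "\<not> (?B w \<or> ?C w)"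
    then have "\<not> ?B w" "\<not> ?C w" by blast+
    show "?A w"
    proof (rule ccontr)
      assume "\<not> ?A w"
      then obtain g where g: "\<And>x. eval (decode (pi1 w)) x = Some (g x)" by metis
      then have "reduction (std_ceer z) (std_ceer z) g"
        using \<open>\<not> ?B w\<close> unfolding reduction_def computable_def by blast
      then obtain k where "(g k, pi2 w) \<in> std_ceer z" using sf unfolding self_full_def by blast
      then show False using \<open>\<not> ?C w\<close> g by blast
    qed
  qed
next
  assume R: "\<forall>w. ?A w \<or> ?B w \<or> ?C w"
  show "self_full (std_ceer z)"
    unfolding self_full_def
  proof (intro conjI allI impI ceer_std_ceer)
    fix g j assume g: "reduction (std_ceer z) (std_ceer z) g"
    then obtain c where "\<forall>x. eval c x = Some (g x)" unfolding reduction_def computable_def by blast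
    moreover obtain e where "decode e = c" using surj_decode by (metis surj_def)
    ultimately have e: "\<And>x. eval (decode e) x = Some (g x)" by blast
    have "\<not> ?B (pair e j)" "\<not> ?A (pair e j)" using g by (auto simp: e reduction_def)
    then have "?C (pair e j)" using R by blast
    then show "\<exists>k. (g k, j) \<in> std_ceer z" by (auto simp: e)
  qed
qed

text \<open>The quantifier over \<open>w\<close> is the outermost one. Inside, negations apply only
  to \<open>Sigma0 1\<close> conditions, so existential quantifiers and Boolean connectives keep the
  matrix in \<open>Sigma0 2\<close>.\<close>

lemma self_full_in_Pi0_3:
  assumes "computable f"
  shows "{i. self_full (std_ceer (f i))} \<in> Pi0 3"
  unfolding self_full_std_ceer_iff numeral_3_eq_3
  by (intro Pi0_SucI sigma_intros comp_intros computable_comp[OF assms])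

section \<open>Ceers with a single nontrivial class\<close>

text \<open>\<open>A \<times> A\<close> is already symmetric and transitive, so the closure adds
  only the diagonal.\<close>

lemma std_ceer_square:
  assumes "W k = {z. pi1 z \<in> A \<and> pi2 z \<in> A}"
  shows "std_ceer k = Id \<union> A \<times> A"
proof -
  have "std_ceer k = (A \<times> A)\<^sup>*"
    unfolding std_ceer_eq assms by (rule arg_cong[of _ _ rtrancl]) auto
  moreover have "(A \<times> A)\<^sup>+ = A \<times> A" by (rule trancl_id) (auto simp: trans_def)
  ultimately show ?thesis by (auto simp: rtrancl_trancl_reflcl)
qed

lemma not_self_full_square:
  assumes c: "computable c" "inj c" and range: "decidable (range c)" "range c \<inter> A = {}"
  shows "\<not> self_full (Id \<union> A \<times> A)"
proof
  \<comment> \<open>\<open>g\<close> shifts \<open>c n\<close> to \<open>c (Suc n)\<close> and fixes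
    everything else. The premise \<open>y \<in> range c\<close> inside \<open>LEAST\<close> makes
    the search succeed for every \<open>y\<close>, so that \<open>g\<close> is computable.\<close>
  define g where "g y = (if y \<in> range c then c (Suc (LEAST n. y \<in> range c \<longrightarrow> c n = y)) else y)" for y
  have g_c: "g (c n) = c (Suc n)" for n
    unfolding g_def using inj_eq[OF c(2)] by (simp add: Least_equality)
  have g_id: "g y = y" if "y \<notin> range c" for y
    unfolding g_def using that by simp
  have c_A: "c n \<notin> A" for n using range(2) by blast
  have rc: "decidable {y. y \<in> range c}" using range(1) by simp
  have "computable g"
    unfolding g_def
    by (intro comp_intros rc decidable_comp[OF rc] computable_comp[OF c(1)]) blast
  moreover have "inj g"
  proof (rule injI)
    fix x y assume "g x = g y"
    then show "x = y"
      using g_c g_id inj_eq[OF c(2)] by (cases "x \<in> range c"; cases "y \<in> range c") auto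
  qed
  moreover have "g x \<in> A \<longleftrightarrow> x \<in> A" for x
    using g_c g_id c_A by (cases "x \<in> range c") auto
  ultimately have "reduction (Id \<union> A \<times> A) (Id \<union> A \<times> A) g"
    unfolding reduction_def by (auto dest: injD)
  moreover assume "self_full (Id \<union> A \<times> A)"
  \<comment> \<open>The class of \<open>c 0\<close> is a singleton, since \<open>c 0\<close> is
    outside \<open>A\<close>, and the shift leaves it without a preimage.\<close>
  ultimately obtain k where "(g k, c 0) \<in> Id \<union> A \<times> A" unfolding self_full_def by blast
  then have k: "g k = c 0" using c_A by auto
  show False
  proof (cases "k \<in> range c")
    case True
    then show False using k g_c inj_eq[OF c(2)] by auto
  next
    case False
    then show False using k g_id by auto
  qed
qed

lemma self_full_square:
  assumes "ceer (Id \<union> A \<times> A)" and meets: "\<And>C. ce C \<Longrightarrow> infinite C \<Longrightarrow> C \<inter> A \<noteq> {}"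
  shows "self_full (Id \<union> A \<times> A)"
  unfolding self_full_def
proof (intro conjI allI impI assms(1))
  let ?E = "Id \<union> A \<times> A"
  fix g j assume "reduction ?E ?E g"
  then have g: "computable g" and red: "\<And>x y. (x, y) \<in> ?E \<longleftrightarrow> (g x, g y) \<in> ?E"
    unfolding reduction_def by blast+
  show "\<exists>k. (g k, j) \<in> ?E"
  proof (rule ccontr)
    assume j: "\<nexists>k. (g k, j) \<in> ?E"
    \<comment> \<open>The orbit of the missed element \<open>j\<close> under
      \<open>g\<close>.\<close>
    define h where "h i = rec_nat j (\<lambda>_ r. g r) i" for i
    have h: "h 0 = j" "h (Suc i) = g (h i)" for i
      by (simp_all add: h_def)
    have "computable h" unfolding h_def by (intro comp_intros computable_comp[OF g])
    \<comment> \<open>Since \<open>g\<close> reflects equivalence, \<open>i\<close> applications of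
      \<open>g\<close> can be cancelled, leaving a value of \<open>g\<close> equivalent to
      \<open>j\<close>.\<close>
    have *: "(h k, h i) \<notin> ?E" if "i < k" for i k
      using that
    proof (induction i arbitrary: k)
      case 0
      then show ?case using j h by (cases k) auto
    next
      case (Suc i)
      then obtain k' where "k = Suc k'" "i < k'" by (metis Suc_lessE)
      then show ?case using Suc.IH[of k'] red[of "h k'" "h i"] by (simp only: h not_False_eq_True)
    qed
    have neq: "h i \<noteq> h k" if "i < k" for i k using *[OF that] by auto
    have inj: "inj h"
      by (rule injI) (metis neq nat_neq_iff)
    \<comment> \<open>Two members of \<open>A\<close> would be equivalent, so after one visit the
      orbit never returns to \<open>A\<close>.\<close>
    have "\<exists>N. \<forall>i\<ge>N. h i \<notin> A"
    proof (cases "\<exists>i. h i \<in> A")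
      case True
      then obtain i where "h i \<in> A" by blast
      then have "\<forall>k\<ge>Suc i. h k \<notin> A" using *[of i] by auto
      then show ?thesis by blast
    qed blast
    then obtain N where N: "\<And>i. h (N + i) \<notin> A" by (meson le_add1)
    have "ce {y. \<exists>i. y = h (N + i)}"
      by (intro ce_if_Sigma0 Sigma0_SucI decidable_imp_Pi0 comp_intros computable_comp[OF \<open>computable h\<close>])
    moreover have "infinite {y. \<exists>i. y = h (N + i)}"
    proof -
      have "inj (\<lambda>i. h (N + i))" by (auto simp: inj_def inj_eq[OF inj])
      then have "infinite (range (\<lambda>i. h (N + i)))" by (simp add: finite_image_iff)
      moreover have "range (\<lambda>i. h (N + i)) = {y. \<exists>i. y = h (N + i)}" by auto
      ultimately show ?thesis by simp
    qed
    ultimately have "{y. \<exists>i. y = h (N + i)} \<inter> A \<noteq> {}" by (rule meets)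
    then show False using N by blast
  qed
qed

section \<open>Hardness\<close>

text \<open>
  \<open>P\<close> picks from each \<open>W e\<close> the first enumerated element beyond column \<open>e\<close>, if there is one.
\<close>

lemma post_set_exists:
  obtains P where "{x. x \<in> P} \<in> Sigma0 (Suc 0)"
    and "\<And>a. finite {y \<in> P. pi1 y = a}"
    and "\<And>C. ce C \<Longrightarrow> (\<And>a. \<exists>y\<in>C. a < pi1 y) \<Longrightarrow> C \<inter> P \<noteq> {}"
proof -
  have "{w. pi1 w < pi1 (pi2 w) \<and> pi2 w \<in> W (pi1 w)} \<in> Sigma0 (Suc 0)"
    by (intro sigma_intros decidable_imp_Sigma0[OF decidable_less] comp_intros)
  then obtain Q where Q: "{w. Q (pi1 w) (pi2 w)} \<in> Pi0 0"
    "\<And>w. pi1 w < pi1 (pi2 w) \<and> pi2 w \<in> W (pi1 w) \<longleftrightarrow> (\<exists>b. Q w b)"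
    using Sigma0_SucE[of "\<lambda>w. pi1 w < pi1 (pi2 w) \<and> pi2 w \<in> W (pi1 w)" 0] by blast
  \<comment> \<open>\<open>t\<close> codes an element of \<open>W e\<close> beyond column
    \<open>e\<close> together with a witness of its enumeration; the first enumerated element is the
    one with the least such \<open>t\<close>.\<close>
  define M where "M e t \<longleftrightarrow> Q (pair e (pi1 t)) (pi2 t)" for e t
  have M_ex: "e < pi1 y \<and> y \<in> W e \<longleftrightarrow> (\<exists>b. M e (pair y b))" for e y
    using Q(2)[of "pair e y"] by (simp add: M_def)
  have M_D: "e < pi1 (pi1 t) \<and> pi1 t \<in> W e" if "M e t" for e t
    using M_ex[of e "pi1 t"] that by (metis pair_pi)
  have M_dec: "decidable {w. M (f w) (g w)}" if "computable f" "computable g" for f g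
    using decidable_comp[of "\<lambda>w. Q (pi1 w) (pi2 w)" "\<lambda>w. pair (pair (f w) (pi1 (g w))) (pi2 (g w))"]
      Q(1) that unfolding M_def by (simp add: comp_intros)
  define P where "P = {y. \<exists>e t. M e t \<and> (\<forall>s<t. \<not> M e s) \<and> y = pi1 t}"
  have "{x. \<exists>e t. M e t \<and> (\<forall>s<t. \<not> M e s) \<and> x = pi1 t} \<in> Sigma0 (Suc 0)"
    by (intro Sigma0_ex decidable_imp_Sigma0 M_dec comp_intros)
  then have "{x. x \<in> P} \<in> Sigma0 (Suc 0)" by (simp only: P_def mem_Collect_eq)
  moreover have "finite {y \<in> P. pi1 y = a}" for a
  proof (rule finite_subset)
    \<comment> \<open>An element of column \<open>a\<close> can be picked only on behalf of some
      \<open>e < a\<close>, and each \<open>e\<close> picks at most once.\<close>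
    show "{y \<in> P. pi1 y = a} \<subseteq> (\<lambda>e. pi1 (LEAST t. M e t)) ` {..<a}"
    proof
      fix y assume "y \<in> {y \<in> P. pi1 y = a}"
      then obtain e t where t: "M e t" "\<forall>s<t. \<not> M e s" "y = pi1 t" "pi1 y = a"
        unfolding P_def by blast
      have "(LEAST t. M e t) = t"
        by (rule Least_equality[of "M e", OF t(1)]) (use t(2) not_le in blast)
      moreover have "e < a" using M_D[OF t(1)] t by simp
      ultimately show "y \<in> (\<lambda>e. pi1 (LEAST t. M e t)) ` {..<a}" using t(3) by auto
    qed
  qed simp
  moreover have "C \<inter> P \<noteq> {}" if "ce C" and unbounded: "\<And>a. \<exists>y\<in>C. a < pi1 y" for C
  proof -
    obtain c where "C = dom (eval c)" using \<open>ce C\<close> unfolding ce_def by blast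
    moreover obtain e where "decode e = c" using surj_decode by (metis surj_def)
    ultimately have C: "C = W e" unfolding W_def by simp
    obtain y where "y \<in> C" "e < pi1 y" using unbounded by blast
    then obtain t where t: "M e t" using M_ex C by blast
    let ?t = "LEAST t. M e t"
    have "M e ?t" using t by (rule LeastI)
    moreover have "\<forall>s<?t. \<not> M e s" using not_less_Least by blast
    ultimately have "pi1 ?t \<in> P" "pi1 ?t \<in> C" using M_D C unfolding P_def by blast+
    then show ?thesis by blast
  qed
  ultimately show ?thesis using that by blast
qed

lemma Pi0_3_matrix:
  assumes "B \<in> Pi0 3"
  obtains D where "decidable {w. D (pi1 (pi1 (pi1 w))) (pi2 (pi1 (pi1 w))) (pi2 (pi1 w)) (pi2 w)}"
    and "\<And>x. x \<in> B \<longleftrightarrow> (\<forall>a. \<exists>b. \<forall>c. D x a b c)"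
proof -
  obtain B1 where B1: "B1 \<in> Sigma0 (Suc (Suc 0))" "\<And>x. x \<in> B \<longleftrightarrow> (\<forall>a. pair x a \<in> B1)"
    using assms unfolding numeral_3_eq_3 Pi0.simps(2)[of "Suc (Suc 0)"] by blast
  obtain B2 where B2: "B2 \<in> Pi0 (Suc 0)" "\<And>x. x \<in> B1 \<longleftrightarrow> (\<exists>b. pair x b \<in> B2)"
    using B1(1) unfolding Sigma0.simps(2)[of "Suc 0"] by blast
  obtain B3 where B3: "decidable B3" "\<And>x. x \<in> B2 \<longleftrightarrow> (\<forall>c. pair x c \<in> B3)"
    using B2(1) by auto
  show ?thesis
    by (rule that[of "\<lambda>x a b c. pair (pair (pair x a) b) c \<in> B3"]) (simp_all add: B1 B2 B3)
qed

text \<open>If \<open>x \<in> B\<close>, every column has finitely many free elements, so an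
  infinite c.e. set avoiding \<open>A x\<close> would reach arbitrarily late columns and meet
  \<open>P\<close>. Otherwise some column has infinitely many free elements, of which
  \<open>P\<close> takes only finitely many, and the shift applies.\<close>

lemma Pi0_3_reduces_to_self_full:
  assumes "B \<in> Pi0 3"
  obtains k where "computable k" "\<And>x. x \<in> B \<longleftrightarrow> self_full (std_ceer (k x))"
proof -
  obtain D where D_dec: "decidable {w. D (pi1 (pi1 (pi1 w))) (pi2 (pi1 (pi1 w))) (pi2 (pi1 w)) (pi2 w)}"
    and D: "\<And>x. x \<in> B \<longleftrightarrow> (\<forall>a. \<exists>b. \<forall>c. D x a b c)"
    using Pi0_3_matrix[OF assms] by blast
  obtain P where P: "{x. x \<in> P} \<in> Sigma0 (Suc 0)" "\<And>a. finite {y \<in> P. pi1 y = a}"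
    "\<And>C. ce C \<Longrightarrow> (\<And>a. \<exists>y\<in>C. a < pi1 y) \<Longrightarrow> C \<inter> P \<noteq> {}"
    using post_set_exists by blast
  \<comment> \<open>\<open>t\<close> bounds refutations of all candidates \<open>b < n\<close>; for
    fixed \<open>n\<close> such a \<open>t\<close> exists iff all of these candidates fail.\<close>
  define S where "S x a n t \<longleftrightarrow> (\<forall>b<n. \<exists>c<t. \<not> D x a b c)" for x a n t
  have D_dec': "decidable {w. D (f w) (g w) (h w) (i w)}"
    if "computable f" "computable g" "computable h" "computable i" for f g h i
    using decidable_comp[OF D_dec, of "\<lambda>w. pair (pair (pair (f w) (g w)) (h w)) (i w)"] that
    by (simp add: comp_intros)
  have "decidable {w. S (pi1 (pi1 (pi1 w))) (pi2 (pi1 (pi1 w))) (pi2 (pi1 w)) (pi2 w)}"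
    unfolding S_def by (intro comp_intros D_dec')
  then have S_dec: "decidable {w. S (f w) (g w) (h w) (i w)}"
    if "computable f" "computable g" "computable h" "computable i" for f g h i
    using decidable_comp[of "\<lambda>w. S (pi1 (pi1 (pi1 w))) (pi2 (pi1 (pi1 w))) (pi2 (pi1 w)) (pi2 w)"
        "\<lambda>w. pair (pair (pair (f w) (g w)) (h w)) (i w)"] that
    by (simp add: comp_intros)
  \<comment> \<open>Column \<open>a\<close> has one free element for each \<open>n\<close> such that every \<open>b < n\<close> admits a \<open>c\<close> with
    \<open>\<not> D x a b c\<close>: minimality of the bound on \<open>c\<close> makes it unique.\<close>
  define free where "free x y \<longleftrightarrow> S x (pi1 y) (pi1 (pi2 y)) (pi2 (pi2 y)) \<and>
    (\<forall>s<pi2 (pi2 y). \<not> S x (pi1 y) (pi1 (pi2 y)) s)" for x y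
  define A where "A x = {y. \<not> free x y \<or> y \<in> P}" for x
  have A_Sigma: "{w. g w \<in> A (f w)} \<in> Sigma0 (Suc 0)" if "computable f" "computable g" for f g
    unfolding A_def free_def mem_Collect_eq
    by (intro Sigma0_or decidable_imp_Sigma0 Sigma0_comp[OF P(1)] S_dec comp_intros
        computable_comp[OF that(1)] computable_comp[OF that(2)])
  have "{w. pi1 (pi2 w) \<in> A (pi1 w) \<and> pi2 (pi2 w) \<in> A (pi1 w)} \<in> Sigma0 (Suc 0)"
    by (intro sigma_intros A_Sigma comp_intros)
  from ce_index[of "\<lambda>x z. pi1 z \<in> A x \<and> pi2 z \<in> A x", OF this]
  obtain k :: "nat \<Rightarrow> nat" where k: "computable k" "\<And>x. W (k x) = {z. pi1 z \<in> A x \<and> pi2 z \<in> A x}"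
    by blast
  have E: "std_ceer (k x) = Id \<union> A x \<times> A x" for x
    by (rule std_ceer_square) (rule k(2))
  have free_eq: "y = pair (pi1 y) (pair (pi1 (pi2 y)) (LEAST t. S x (pi1 y) (pi1 (pi2 y)) t))"
    if "free x y" for x y
  proof -
    have "(LEAST t. S x (pi1 y) (pi1 (pi2 y)) t) = pi2 (pi2 y)"
      by (rule Least_equality) (use that not_le in \<open>auto simp: free_def\<close>)
    then show ?thesis by simp
  qed
  have "x \<in> B \<longleftrightarrow> self_full (std_ceer (k x))" for x
  proof
    assume "x \<in> B"
    have fin: "finite {y. free x y \<and> pi1 y = a}" for a
    proof -
      obtain b where b: "\<And>c. D x a b c" using \<open>x \<in> B\<close> D by blast
      have "{y. free x y \<and> pi1 y = a} \<subseteq> (\<lambda>n. pair a (pair n (LEAST t. S x a n t))) ` {..b}"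
      proof
        fix y assume "y \<in> {y. free x y \<and> pi1 y = a}"
        then have y: "free x y" "pi1 y = a" by auto
        \<comment> \<open>The true witness \<open>b\<close> is never refuted, so \<open>S\<close>
          fails for every \<open>n > b\<close>.\<close>
        have "pi1 (pi2 y) \<le> b"
          using y b unfolding free_def S_def not_less[symmetric] by blast
        then show "y \<in> (\<lambda>n. pair a (pair n (LEAST t. S x a n t))) ` {..b}"
          using free_eq[OF y(1)] unfolding y(2) by blast
      qed
      then show ?thesis by (rule finite_subset) simp
    qed
    show "self_full (std_ceer (k x))"
      unfolding E
    proof (rule self_full_square)
      show "ceer (Id \<union> A x \<times> A x)" using ceer_std_ceer[of "k x"] unfolding E .
      fix C assume "ce C" "infinite C"
      show "C \<inter> A x \<noteq> {}"
      proof
        assume disj: "C \<inter> A x = {}"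
        have "\<exists>y\<in>C. a < pi1 y" for a
        proof (rule ccontr)
          assume "\<not> (\<exists>y\<in>C. a < pi1 y)"
          then have "C \<subseteq> (\<Union>a'\<le>a. {y. free x y \<and> pi1 y = a'})"
            using disj by (auto simp: A_def not_less)
          then have "finite C" by (rule finite_subset) (simp add: fin)
          then show False using \<open>infinite C\<close> by simp
        qed
        then have "C \<inter> P \<noteq> {}" using P(3) \<open>ce C\<close> by blast
        then show False using disj by (auto simp: A_def)
      qed
    qed
  next
    assume sf: "self_full (std_ceer (k x))"
    show "x \<in> B"
    proof (rule ccontr)
      assume "x \<notin> B"
      then obtain a where a: "\<And>b. \<exists>c. \<not> D x a b c" using D by blast
      have ex: "\<exists>t. S x a n t" for n
      proof -
        obtain F where F: "\<And>b. \<not> D x a b (F b)" using a by metis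
        have "F b < Suc (Max (F ` {..<n}))" if "b < n" for b
          using that by (simp add: less_Suc_eq_le)
        then show ?thesis unfolding S_def using F by blast
      qed
      \<comment> \<open>Lists the free elements of the bad column \<open>a\<close>; the least bound
        exists because every candidate is refuted there.\<close>
      define e where "e n = pair a (pair n (LEAST t. S x a n t))" for n
      have "computable e"
        unfolding e_def by (intro comp_intros S_dec ex)
      have "inj e" by (auto simp: inj_def e_def)
      have free_e: "free x (e n)" for n
      proof -
        have "S x a n (LEAST t. S x a n t)" by (rule LeastI_ex[OF ex])
        moreover have "\<forall>s<(LEAST t. S x a n t). \<not> S x a n s" using not_less_Least by blast
        ultimately show ?thesis
          unfolding free_def e_def prod_encode_inverse fst_conv snd_conv by blast
      qed
      \<comment> \<open>Dropping an initial segment of the list removes the finitely many members of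
        \<open>P\<close> in this column.\<close>
      have "finite (e -` {y \<in> P. pi1 y = a})"
        by (rule finite_vimageI) (use P(2) \<open>inj e\<close> in auto)
      then obtain N where N: "\<And>n. n \<in> e -` {y \<in> P. pi1 y = a} \<Longrightarrow> n < N"
        unfolding finite_nat_set_iff_bounded by blast
      have "e (N + n) \<notin> A x" for n
        using N[of "N + n"] free_e[of "N + n"] by (auto simp: A_def) (auto simp: e_def)
      then have disj: "range (\<lambda>n. e (N + n)) \<inter> A x = {}" by blast
      \<comment> \<open>The range is decidable because the only possible position of
        \<open>y\<close> in the list can be read off as \<open>pi1 (pi2 y)\<close>.\<close>
      have "range (\<lambda>n. e (N + n)) = {y. N \<le> pi1 (pi2 y) \<and> y = e (pi1 (pi2 y))}"
        by (auto simp: e_def image_iff) (metis le_add_diff_inverse)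
      moreover have "decidable {y. N \<le> pi1 (pi2 y) \<and> y = e (pi1 (pi2 y))}"
        by (intro comp_intros computable_comp[OF \<open>computable e\<close>])
      ultimately have "decidable (range (\<lambda>n. e (N + n)))" by (simp only:)
      moreover have "computable (\<lambda>n. e (N + n))"
        by (intro comp_intros computable_comp[OF \<open>computable e\<close>])
      moreover have "inj (\<lambda>n. e (N + n))" by (auto simp: inj_def inj_eq[OF \<open>inj e\<close>])
      ultimately show False using not_self_full_square disj sf unfolding E by blast
    qed
  qed
  then show ?thesis using that k(1) by blast
qed

text \<open>The translation into the standard indexing transfers the upper bound, and the one out of
  it transfers hardness.\<close>

theorem theorem12p2:
  fixes R :: "nat \<Rightarrow> (nat \<times> nat) set"
  assumes "acceptable_ceer_indexing R"
  shows "complete_for (Pi0 3) {i. self_full (R i)}"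
proof -
  obtain f g where f: "computable f" "\<And>z. R z = std_ceer (f z)"
    and g: "computable g" "\<And>z. std_ceer z = R (g z)"
    using assms unfolding acceptable_ceer_indexing_def by blast
  have "{i. self_full (R i)} \<in> Pi0 3"
    unfolding f(2) by (rule self_full_in_Pi0_3[OF f(1)])
  moreover have "many_one_reducible B {i. self_full (R i)}" if B: "B \<in> Pi0 3" for B
  proof -
    obtain k where k: "computable k" "\<And>x. x \<in> B \<longleftrightarrow> self_full (std_ceer (k x))"
      using Pi0_3_reduces_to_self_full[OF B] by blast
    show ?thesis
      unfolding many_one_reducible_def
    proof (intro exI conjI allI)
      show "computable (\<lambda>x. g (k x))" by (rule computable_comp[OF g(1) k(1)])
      show "x \<in> B \<longleftrightarrow> g (k x) \<in> {i. self_full (R i)}" for x by (simp add: k(2) g(2))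
    qed
  qed
  ultimately show ?thesis unfolding complete_for_def by blast
qed

end
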